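(* Let $(M,g)$ be a $2$-Riemannian manifold. Then the $2$-Riemannian pseudoconnection $\nabla^g$ of $g$ has no Koszul derivative; that is, there is no map $D:\mathcal{X}\times\mathcal{X}\to\mathcal{X}$ such that $\nabla^g_XY=P^g(D_XY)$ for all $X,Y\in\mathcal{X}$, where $P^g$ is the principal homomorphism of $\nabla^g$.
   Context: Manifolds are $C^\infty$; $\mathcal{X}$ denotes the $C^\infty$ vector fields on $M$. A $2$-inner product on a real vector space $V$ is a map $g:V\times V\times V\to\mathbb{R}$, written $g(u,v/w)$, such that for all $u,u',v,w\in V$, $\alpha\in\mathbb{R}$: (1) $g(u,u/v)\ge 0$, and $g(u,u/v)=0$ iff $u,v$ are linearly dependent; (2) $g(u,u/v)=g(v,v/u)$; (3) $g(u,v/w)=g(v,u/w)$; (4) $g(\alpha u+u',v/w)=\alpha g(u,v/w)+g(u',v/w)$. A $2$-Riemannian metric on $M$ is an assignment $g$ of a $2$-inner product $g_p$ to each $T_pM$ such that $g(X,Y/Z):p\mapsto g_p(X(p),Y(p)/Z(p))$ is $C^\infty$ for all $X,Y,Z\in\mathcal{X}$; then $(M,g)$ is a $2$-Riemannian manifold. $\mathfrak{D}^2_0(M)$ is the $C^\infty(M)$-module of all maps $d:\mathcal{X}\times\mathcal{X}\to C^\infty(M)$ that are $C^\infty(M)$-linear in the first variable. A $\mathfrak{D}^2_0(M)$-pseudoconnection of $TM$ is an $\mathbb{R}$-bilinear map $\nabla:\mathcal{X}\times\mathcal{X}\to\mathfrak{D}^2_0(M)$ for which there is a $C^\infty(M)$-module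 homomorphism $P:\mathcal{X}\to\mathfrak{D}^2_0(M)$ (the principal homomorphism) with $\nabla_{\varphi X}Y=\varphi\nabla_XY$ and $\nabla_X(\varphi Y)=X(\varphi)P(Y)+\varphi\nabla_XY$ for all $X,Y\in\mathcal{X}$ and $\varphi\in C^\infty(M)$. It is torsion free if $\nabla_XY-\nabla_YX=P([X,Y])$ for all $X,Y\in\mathcal{X}$, and compatible if $X(P(Y)(Z,W))=\nabla_XY(Z,W)+\nabla_XZ(Y,W)$ for all $X,Y,Z,W\in\mathcal{X}$. The $2$-Riemannian pseudoconnection $\nabla^g$ of $g$ is the unique torsion free compatible $\mathfrak{D}^2_0(M)$-pseudoconnection of $TM$ with principal homomorphism $P^g(X)(Y,Z)=g(X,Y/Z)$. Explicitly, $$\nabla^g_XY(Z,W)=\tfrac12\{Xg(Y,Z/W)+Yg(Z,X/W)-Zg(X,Y/W)+g([X,Y],Z/W)+g([Z,X],Y/W)-g([Y,Z],X/W)\}.$$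
   Formalization: The manifold M is taken nonempty and of dimension at least 2; in dimension 0 or 1 every pair of tangent vectors is dependent, so g = 0, the pseudoconnection vanishes, and D = 0 is a Koszul derivative, so the claim fails there. *)

theory Defs
  imports "HOL-Analysis.Analysis" "HOL-Library.Function_Algebras"
begin

section \<open>Pointwise vector space structure on functions\<close>

instantiation "fun" :: (type, real_vector) real_vector
begin

definition scaleR_fun :: "real \<Rightarrow> ('a \<Rightarrow> 'b) \<Rightarrow> 'a \<Rightarrow> 'b"
  where "scaleR_fun a f = (\<lambda>x. a *\<^sub>R f x)"

instance
  by standard (auto simp: scaleR_fun_def fun_eq_iff scaleR_add_left scaleR_add_right)

end

lemma scaleR_fun_apply [simp]: "(a *\<^sub>R f) x = a *\<^sub>R f x"
  by (simp add: scaleR_fun_def)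


section \<open>Smooth manifolds\<close>

primrec Ck_on ::
    "nat \<Rightarrow> ('a::euclidean_space \<Rightarrow> 'b::real_normed_vector) \<Rightarrow> 'a set \<Rightarrow> bool"
  where
    "Ck_on 0 f S \<longleftrightarrow> continuous_on S f"
  | "Ck_on (Suc k) f S \<longleftrightarrow>
      (\<forall>x\<in>S. f differentiable at x) \<and> (\<forall>v. Ck_on k (\<lambda>x. frechet_derivative f (at x) v) S)"

text \<open>Used for open \<^term>\<open>S\<close> only.\<close>

definition smooth_on :: "('a::euclidean_space \<Rightarrow> 'b::real_normed_vector) \<Rightarrow> 'a set \<Rightarrow> bool"
  where "smooth_on f S \<longleftrightarrow> (\<forall>k. Ck_on k f S)"

text \<open>
  The underlying space of a manifold is a whole type; its dimension is the dimension of the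
  model space \<^typ>\<open>'e\<close>. A chart is a pair of its domain and its coordinate map.
  The atlas need not be maximal: any smooth atlas determines the smooth structure.
\<close>

type_synonym ('a, 'e) chart = "'a set \<times> ('a \<Rightarrow> 'e)"

definition is_chart :: "('a::topological_space, 'e::euclidean_space) chart \<Rightarrow> bool"
  where "is_chart c \<longleftrightarrow> (case c of (U, \<phi>) \<Rightarrow>
    open U \<and> open (\<phi> ` U) \<and> homeomorphism U (\<phi> ` U) \<phi> (inv_into U \<phi>))"

definition smooth_manifold ::
    "('a::{t2_space, second_countable_topology}, 'e::euclidean_space) chart set \<Rightarrow> bool"
  where "smooth_manifold A \<longleftrightarrow>
    (\<forall>c\<in>A. is_chart c) \<and>
    (\<Union>(U, \<phi>)\<in>A. U) = UNIV \<and>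
    (\<forall>(U, \<phi>)\<in>A. \<forall>(V, \<psi>)\<in>A. smooth_on (\<psi> \<circ> inv_into U \<phi>) (\<phi> ` (U \<inter> V)))"

definition smooth_functions ::
    "('a::topological_space, 'e::euclidean_space) chart set \<Rightarrow> ('a \<Rightarrow> real) set"
  where "smooth_functions A = {f. \<forall>(U, \<phi>)\<in>A. smooth_on (f \<circ> inv_into U \<phi>) (\<phi> ` U)}"

text \<open>
  Tangent vectors at \<^term>\<open>p\<close> are the derivations at \<^term>\<open>p\<close> of the algebra of smooth functions,
  set to \<open>0\<close> on non-smooth functions so that a derivation is a unique HOL function.
\<close>

type_synonym 'a tangent = "('a \<Rightarrow> real) \<Rightarrow> real"

definition tangent_space ::
    "('a::topological_space, 'e::euclidean_space) chart set \<Rightarrow> 'a \<Rightarrow> 'a tangent set"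
  where "tangent_space A p = {v.
    (\<forall>f. f \<notin> smooth_functions A \<longrightarrow> v f = 0) \<and>
    (\<forall>f\<in>smooth_functions A. \<forall>h\<in>smooth_functions A. v (f + h) = v f + v h) \<and>
    (\<forall>a. \<forall>f\<in>smooth_functions A. v (a *\<^sub>R f) = a * v f) \<and>
    (\<forall>f\<in>smooth_functions A. \<forall>h\<in>smooth_functions A. v (f * h) = f p * v h + v f * h p)}"

type_synonym 'a vfield = "'a \<Rightarrow> 'a tangent"

definition vf_apply :: "'a vfield \<Rightarrow> ('a \<Rightarrow> real) \<Rightarrow> 'a \<Rightarrow> real"
  where "vf_apply X f = (\<lambda>p. X p f)"

definition vector_fields ::
    "('a::topological_space, 'e::euclidean_space) chart set \<Rightarrow> 'a vfield set"
  where "vector_fields A = {X.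
    (\<forall>p. X p \<in> tangent_space A p) \<and>
    (\<forall>f\<in>smooth_functions A. vf_apply X f \<in> smooth_functions A)}"

definition vf_mult :: "('a \<Rightarrow> real) \<Rightarrow> 'a vfield \<Rightarrow> 'a vfield"
  where "vf_mult \<phi> X = (\<lambda>p. \<phi> p *\<^sub>R X p)"

definition lie_bracket :: "'a vfield \<Rightarrow> 'a vfield \<Rightarrow> 'a vfield"
  where "lie_bracket X Y = (\<lambda>p f. X p (vf_apply Y f) - Y p (vf_apply X f))"


section \<open>2-Riemannian metrics\<close>

text \<open>
  \<open>g u v w\<close> stands for $g(u,v/w)$. The set \<^term>\<open>V\<close> is meant to be a subspace of \<^typ>\<open>'v\<close>;
  \<^const>\<open>dependent\<close> is not used for the pair, as \<open>{u, u}\<close> would collapse to a singleton.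
\<close>

definition lin_dep_pair :: "'v::real_vector \<Rightarrow> 'v \<Rightarrow> bool"
  where "lin_dep_pair u v \<longleftrightarrow> (\<exists>a b. (a \<noteq> 0 \<or> b \<noteq> 0) \<and> a *\<^sub>R u + b *\<^sub>R v = 0)"

definition two_inner_product :: "'v::real_vector set \<Rightarrow> ('v \<Rightarrow> 'v \<Rightarrow> 'v \<Rightarrow> real) \<Rightarrow> bool"
  where "two_inner_product V g \<longleftrightarrow>
    (\<forall>u\<in>V. \<forall>v\<in>V. g u u v \<ge> 0 \<and> (g u u v = 0 \<longleftrightarrow> lin_dep_pair u v)) \<and>
    (\<forall>u\<in>V. \<forall>v\<in>V. g u u v = g v v u) \<and>
    (\<forall>u\<in>V. \<forall>v\<in>V. \<forall>w\<in>V. g u v w = g v u w) \<and>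
    (\<forall>a. \<forall>u\<in>V. \<forall>u'\<in>V. \<forall>v\<in>V. \<forall>w\<in>V. g (a *\<^sub>R u + u') v w = a * g u v w + g u' v w)"

type_synonym 'a metric2 = "'a \<Rightarrow> 'a tangent \<Rightarrow> 'a tangent \<Rightarrow> 'a tangent \<Rightarrow> real"

definition metric_fun :: "'a metric2 \<Rightarrow> 'a vfield \<Rightarrow> 'a vfield \<Rightarrow> 'a vfield \<Rightarrow> 'a \<Rightarrow> real"
  where "metric_fun g X Y Z = (\<lambda>p. g p (X p) (Y p) (Z p))"

definition two_riemannian_metric ::
    "('a::topological_space, 'e::euclidean_space) chart set \<Rightarrow> 'a metric2 \<Rightarrow> bool"
  where "two_riemannian_metric A g \<longleftrightarrow>
    (\<forall>p. two_inner_product (tangent_space A p) (g p)) \<and>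
    (\<forall>X\<in>vector_fields A. \<forall>Y\<in>vector_fields A. \<forall>Z\<in>vector_fields A.
      metric_fun g X Y Z \<in> smooth_functions A)"


section \<open>Pseudoconnections\<close>

text \<open>
  Elements of $\mathfrak{D}^2_0(M)$ are maps on pairs of smooth vector fields; they are set to
  \<open>0\<close> elsewhere, so that equality of such maps is HOL equality.
\<close>

type_synonym 'a dmap = "'a vfield \<Rightarrow> 'a vfield \<Rightarrow> 'a \<Rightarrow> real"

definition D20 :: "('a::topological_space, 'e::euclidean_space) chart set \<Rightarrow> 'a dmap set"
  where "D20 A = {d.
    (\<forall>Z W. Z \<notin> vector_fields A \<or> W \<notin> vector_fields A \<longrightarrow> d Z W = 0) \<and>
    (\<forall>Z\<in>vector_fields A. \<forall>W\<in>vector_fields A. d Z W \<in> smooth_functions A) \<and>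
    (\<forall>\<phi>\<in>smooth_functions A. \<forall>Z\<in>vector_fields A. \<forall>Z'\<in>vector_fields A. \<forall>W\<in>vector_fields A.
      d (vf_mult \<phi> Z + Z') W = \<phi> * d Z W + d Z' W)}"

definition d_mult :: "('a \<Rightarrow> real) \<Rightarrow> 'a dmap \<Rightarrow> 'a dmap"
  where "d_mult \<phi> d = (\<lambda>Z W. \<phi> * d Z W)"

definition D20_hom ::
    "('a::topological_space, 'e::euclidean_space) chart set \<Rightarrow> ('a vfield \<Rightarrow> 'a dmap) \<Rightarrow> bool"
  where "D20_hom A P \<longleftrightarrow>
    (\<forall>X\<in>vector_fields A. P X \<in> D20 A) \<and>
    (\<forall>X\<in>vector_fields A. \<forall>Y\<in>vector_fields A. P (X + Y) = P X + P Y) \<and>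
    (\<forall>\<phi>\<in>smooth_functions A. \<forall>X\<in>vector_fields A. P (vf_mult \<phi> X) = d_mult \<phi> (P X))"

definition pseudoconnection ::
    "('a::topological_space, 'e::euclidean_space) chart set \<Rightarrow> ('a vfield \<Rightarrow> 'a dmap) \<Rightarrow>
      ('a vfield \<Rightarrow> 'a vfield \<Rightarrow> 'a dmap) \<Rightarrow> bool"
  where "pseudoconnection A P nabla \<longleftrightarrow>
    D20_hom A P \<and>
    (\<forall>X\<in>vector_fields A. \<forall>Y\<in>vector_fields A. nabla X Y \<in> D20 A) \<and>
    (\<forall>a. \<forall>X\<in>vector_fields A. \<forall>X'\<in>vector_fields A. \<forall>Y\<in>vector_fields A.
      nabla (a *\<^sub>R X + X') Y = a *\<^sub>R nabla X Y + nabla X' Y) \<and>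
    (\<forall>a. \<forall>X\<in>vector_fields A. \<forall>Y\<in>vector_fields A. \<forall>Y'\<in>vector_fields A.
      nabla X (a *\<^sub>R Y + Y') = a *\<^sub>R nabla X Y + nabla X Y') \<and>
    (\<forall>\<phi>\<in>smooth_functions A. \<forall>X\<in>vector_fields A. \<forall>Y\<in>vector_fields A.
      nabla (vf_mult \<phi> X) Y = d_mult \<phi> (nabla X Y) \<and>
      nabla X (vf_mult \<phi> Y) = d_mult (vf_apply X \<phi>) (P Y) + d_mult \<phi> (nabla X Y))"

definition torsion_free ::
    "('a::topological_space, 'e::euclidean_space) chart set \<Rightarrow> ('a vfield \<Rightarrow> 'a dmap) \<Rightarrow>
      ('a vfield \<Rightarrow> 'a vfield \<Rightarrow> 'a dmap) \<Rightarrow> bool"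
  where "torsion_free A P nabla \<longleftrightarrow>
    (\<forall>X\<in>vector_fields A. \<forall>Y\<in>vector_fields A. nabla X Y - nabla Y X = P (lie_bracket X Y))"

definition compatible ::
    "('a::topological_space, 'e::euclidean_space) chart set \<Rightarrow> ('a vfield \<Rightarrow> 'a dmap) \<Rightarrow>
      ('a vfield \<Rightarrow> 'a vfield \<Rightarrow> 'a dmap) \<Rightarrow> bool"
  where "compatible A P nabla \<longleftrightarrow>
    (\<forall>X\<in>vector_fields A. \<forall>Y\<in>vector_fields A. \<forall>Z\<in>vector_fields A. \<forall>W\<in>vector_fields A.
      vf_apply X (P Y Z W) = nabla X Y Z W + nabla X Z Y W)"

definition metric_hom ::
    "('a::topological_space, 'e::euclidean_space) chart set \<Rightarrow> 'a metric2 \<Rightarrow> 'a vfield \<Rightarrow> 'a dmap"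
  where "metric_hom A g X = (\<lambda>Y Z.
    if Y \<in> vector_fields A \<and> Z \<in> vector_fields A then metric_fun g X Y Z else 0)"

text \<open>
  The defining property of $\nabla^g$. Existence and uniqueness (on smooth vector fields) are
  lemma \<open>two_riemannian_pseudoconnection_iff\<close> below.
\<close>

definition two_riemannian_pseudoconnection ::
    "('a::topological_space, 'e::euclidean_space) chart set \<Rightarrow> 'a metric2 \<Rightarrow>
      ('a vfield \<Rightarrow> 'a vfield \<Rightarrow> 'a dmap) \<Rightarrow> bool"
  where "two_riemannian_pseudoconnection A g nabla \<longleftrightarrow>
    pseudoconnection A (metric_hom A g) nabla \<and>
    torsion_free A (metric_hom A g) nabla \<and>
    compatible A (metric_hom A g) nabla"

definition koszul_derivative ::
    "('a::topological_space, 'e::euclidean_space) chart set \<Rightarrow> ('a vfield \<Rightarrow> 'a dmap) \<Rightarrow>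
      ('a vfield \<Rightarrow> 'a vfield \<Rightarrow> 'a dmap) \<Rightarrow> ('a vfield \<Rightarrow> 'a vfield \<Rightarrow> 'a vfield) \<Rightarrow> bool"
  where "koszul_derivative A P nabla D \<longleftrightarrow>
    (\<forall>X\<in>vector_fields A. \<forall>Y\<in>vector_fields A.
      D X Y \<in> vector_fields A \<and> nabla X Y = P (D X Y))"

definition koszul_formula ::
    "('a::topological_space, 'e::euclidean_space) chart set \<Rightarrow> 'a metric2 \<Rightarrow>
      'a vfield \<Rightarrow> 'a vfield \<Rightarrow> 'a dmap"
  where "koszul_formula A g X Y = (\<lambda>Z W.
    if Z \<in> vector_fields A \<and> W \<in> vector_fields A then
      (1/2) *\<^sub>R (vf_apply X (metric_fun g Y Z W) + vf_apply Y (metric_fun g Z X W)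
        - vf_apply Z (metric_fun g X Y W) + metric_fun g (lie_bracket X Y) Z W
        + metric_fun g (lie_bracket Z X) Y W - metric_fun g (lie_bracket Y Z) X W)
    else 0)"


section \<open>Existence and uniqueness of the 2-Riemannian pseudoconnection\<close>

lemma Ck_on_cong:
  assumes "open S" "\<And>x. x \<in> S \<Longrightarrow> f x = h x" "Ck_on k f S"
  shows "Ck_on k h S"
  using assms(2,3)
proof (induction k arbitrary: f h)
  case 0
  then show ?case by (metis Ck_on.simps(1) continuous_on_cong)
next
  case (Suc k)
  have D: "(h has_derivative frechet_derivative f (at x)) (at x)" if "x \<in> S" for x
  proof (rule has_derivative_transform_within_open[OF _ assms(1) that])
    show "(f has_derivative frechet_derivative f (at x)) (at x)"
      using Suc.prems(2) that by (simp add: frechet_derivative_works)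
  qed (use Suc.prems(1) in auto)
  have "Ck_on k (\<lambda>x. frechet_derivative h (at x) v) S" for v
  proof (rule Suc.IH)
    show "Ck_on k (\<lambda>x. frechet_derivative f (at x) v) S"
      using Suc.prems(2) by simp
    show "frechet_derivative f (at x) v = frechet_derivative h (at x) v" if "x \<in> S" for x
      using frechet_derivative_at[OF D[OF that]] by simp
  qed
  moreover have "\<forall>x\<in>S. h differentiable at x"
    using D by (auto simp: differentiable_def)
  ultimately show ?case by simp
qed

lemma Ck_on_Suc_D: "Ck_on (Suc k) f S \<Longrightarrow> Ck_on k f S"
proof (induction k arbitrary: f)
  case 0
  then show ?case
    by (auto intro!: continuous_at_imp_continuous_on differentiable_imp_continuous_within)
next
  case (Suc k)
  then show ?case by (metis Ck_on.simps(2))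
qed

lemma Ck_on_const: "Ck_on k (\<lambda>x. c) S"
  by (induction k arbitrary: c) (auto simp: frechet_derivative_const)

lemma Ck_on_add:
  assumes "open S" "Ck_on k f S" "Ck_on k h S"
  shows "Ck_on k (\<lambda>x. f x + h x) S"
  using assms(2,3)
proof (induction k arbitrary: f h)
  case 0
  then show ?case by (simp add: continuous_on_add)
next
  case (Suc k)
  have eq: "frechet_derivative f (at x) v + frechet_derivative h (at x) v
      = frechet_derivative (\<lambda>x. f x + h x) (at x) v" if "x \<in> S" for x v
  proof -
    have "(f has_derivative frechet_derivative f (at x)) (at x)"
      "(h has_derivative frechet_derivative h (at x)) (at x)"
      using Suc.prems that by (simp_all add: frechet_derivative_works)
    from frechet_derivative_at[OF has_derivative_add[OF this]]
    show ?thesis by metis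
  qed
  have "Ck_on k (\<lambda>x. frechet_derivative (\<lambda>x. f x + h x) (at x) v) S" for v
    by (rule Ck_on_cong[OF assms(1) eq Suc.IH]) (use Suc.prems in auto)
  then show ?case using Suc.prems by simp
qed

lemma Ck_on_mult:
  fixes f h :: "'a::euclidean_space \<Rightarrow> real"
  assumes "open S" "Ck_on k f S" "Ck_on k h S"
  shows "Ck_on k (\<lambda>x. f x * h x) S"
  using assms(2,3)
proof (induction k arbitrary: f h)
  case 0
  then show ?case by (simp add: continuous_on_mult)
next
  case (Suc k)
  have 1: "Ck_on k (\<lambda>x. f x * frechet_derivative h (at x) v) S" for v
    using Suc.IH[OF Ck_on_Suc_D[OF Suc.prems(1)]] Suc.prems(2) by simp
  have 2: "Ck_on k (\<lambda>x. frechet_derivative f (at x) v * h x) S" for v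
    using Suc.IH[OF _ Ck_on_Suc_D[OF Suc.prems(2)]] Suc.prems(1) by simp
  have eq: "f x * frechet_derivative h (at x) v + frechet_derivative f (at x) v * h x
      = frechet_derivative (\<lambda>x. f x * h x) (at x) v" if "x \<in> S" for x v
  proof -
    have "(f has_derivative frechet_derivative f (at x)) (at x)"
      "(h has_derivative frechet_derivative h (at x)) (at x)"
      using Suc.prems that by (simp_all add: frechet_derivative_works)
    from frechet_derivative_at[OF has_derivative_mult[OF this]]
    show ?thesis by metis
  qed
  have "Ck_on k (\<lambda>x. frechet_derivative (\<lambda>x. f x * h x) (at x) v) S" for v
    by (rule Ck_on_cong[OF assms(1) eq Ck_on_add[OF assms(1) 1 2]])
  then show ?case using Suc.prems by (auto intro!: differentiable_mult)
qed

lemma smooth_functions_const: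
  "(\<lambda>x. c) \<in> smooth_functions A"
  by (auto simp: smooth_functions_def smooth_on_def o_def Ck_on_const)

context
  fixes A :: "('a::{t2_space, second_countable_topology}, 'e::euclidean_space) chart set"
  assumes A: "smooth_manifold A"
begin

lemma chart_open: "(U, \<phi>) \<in> A \<Longrightarrow> open (\<phi> ` U)"
  using A by (auto simp: smooth_manifold_def is_chart_def)

lemma smooth_functions_add:
  "f \<in> smooth_functions A \<Longrightarrow> h \<in> smooth_functions A \<Longrightarrow> f + h \<in> smooth_functions A"
  using Ck_on_add[OF chart_open] by (fastforce simp: smooth_functions_def smooth_on_def o_def)

lemma smooth_functions_mult:
  "f \<in> smooth_functions A \<Longrightarrow> h \<in> smooth_functions A \<Longrightarrow> f * h \<in> smooth_functions A"
  using Ck_on_mult[OF chart_open] by (fastforce simp: smooth_functions_def smooth_on_def o_def)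

lemma smooth_functions_scaleR:
  assumes "f \<in> smooth_functions A" shows "a *\<^sub>R f \<in> smooth_functions A"
proof -
  have "a *\<^sub>R f = (\<lambda>x. a) * f" by (simp add: fun_eq_iff)
  then show ?thesis using smooth_functions_mult[OF smooth_functions_const assms] by simp
qed

lemma smooth_functions_zero: "0 \<in> smooth_functions A"
  using smooth_functions_const[of 0] by (simp add: zero_fun_def)

lemma smooth_functions_diff:
  assumes "f \<in> smooth_functions A" "h \<in> smooth_functions A" shows "f - h \<in> smooth_functions A"
proof -
  have "f - h = f + (-1) *\<^sub>R h" by (simp add: fun_eq_iff)
  then show ?thesis using assms smooth_functions_add smooth_functions_scaleR by metis
qed

lemma subspace_tangent_space: "subspace (tangent_space A p)"
  by (auto simp: subspace_def tangent_space_def algebra_simps)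

lemma vf_tangent: "X \<in> vector_fields A \<Longrightarrow> X p \<in> tangent_space A p"
  by (simp add: vector_fields_def)

lemma vf_smooth:
  "X \<in> vector_fields A \<Longrightarrow> f \<in> smooth_functions A \<Longrightarrow> vf_apply X f \<in> smooth_functions A"
  by (simp add: vector_fields_def)

lemma vf_add:
  assumes "X \<in> vector_fields A" "f \<in> smooth_functions A" "h \<in> smooth_functions A"
  shows "X p (f + h) = X p f + X p h"
  using vf_tangent[OF assms(1), of p] assms by (auto simp: tangent_space_def)

lemma vf_scaleR:
  assumes "X \<in> vector_fields A" "f \<in> smooth_functions A"
  shows "X p (a *\<^sub>R f) = a * X p f"
  using vf_tangent[OF assms(1), of p] assms by (auto simp: tangent_space_def)

lemma vf_leibniz:
  assumes "X \<in> vector_fields A" "f \<in> smooth_functions A" "h \<in> smooth_functions A"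
  shows "X p (f * h) = f p * X p h + X p f * h p"
  using vf_tangent[OF assms(1), of p] assms by (auto simp: tangent_space_def)

lemma vf_nonsmooth: "X \<in> vector_fields A \<Longrightarrow> f \<notin> smooth_functions A \<Longrightarrow> X p f = 0"
  using vf_tangent[of X p] by (auto simp: tangent_space_def)

lemma vector_fields_add:
  assumes "X \<in> vector_fields A" "Y \<in> vector_fields A" shows "X + Y \<in> vector_fields A"
proof -
  have "vf_apply (X + Y) f = vf_apply X f + vf_apply Y f" for f
    by (simp add: vf_apply_def fun_eq_iff)
  then show ?thesis
    using assms subspace_add[OF subspace_tangent_space]
    by (auto simp: vector_fields_def intro!: smooth_functions_add)
qed

lemma vector_fields_mult:
  assumes "\<phi> \<in> smooth_functions A" "X \<in> vector_fields A" shows "vf_mult \<phi> X \<in> vector_fields A"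
proof -
  have "vf_apply (vf_mult \<phi> X) f = \<phi> * vf_apply X f" for f
    by (simp add: vf_apply_def vf_mult_def fun_eq_iff)
  then show ?thesis
    using assms subspace_scale[OF subspace_tangent_space]
    by (auto simp: vector_fields_def intro!: smooth_functions_mult) (simp add: vf_mult_def)
qed

lemma vf_mult_const: "vf_mult (\<lambda>p. a) X = a *\<^sub>R X"
  by (simp add: vf_mult_def fun_eq_iff)

lemma vector_fields_scaleR: "X \<in> vector_fields A \<Longrightarrow> a *\<^sub>R X \<in> vector_fields A"
  using vector_fields_mult[OF smooth_functions_const] by (simp add: vf_mult_const)

lemma vf_apply_vf_apply_leibniz:
  assumes "X \<in> vector_fields A" "Y \<in> vector_fields A" "f \<in> smooth_functions A" "h \<in> smooth_functions A"
  shows "X p (vf_apply Y (f * h))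
    = f p * X p (vf_apply Y h) + X p f * Y p h + Y p f * X p h + X p (vf_apply Y f) * h p"
proof -
  have "vf_apply Y (f * h) = f * vf_apply Y h + vf_apply Y f * h"
    using assms by (simp add: fun_eq_iff vf_apply_def vf_leibniz)
  then have "X p (vf_apply Y (f * h)) = X p (f * vf_apply Y h) + X p (vf_apply Y f * h)"
    using assms by (simp add: vf_add vf_smooth smooth_functions_mult)
  then show ?thesis
    using assms by (simp add: vf_leibniz vf_smooth) (simp add: vf_apply_def)
qed

lemma vf_apply_add:
  "X \<in> vector_fields A \<Longrightarrow> f \<in> smooth_functions A \<Longrightarrow> h \<in> smooth_functions A \<Longrightarrow>
    vf_apply X (f + h) = vf_apply X f + vf_apply X h"
  by (simp add: vf_apply_def fun_eq_iff vf_add)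

lemma vf_apply_scaleR:
  "X \<in> vector_fields A \<Longrightarrow> f \<in> smooth_functions A \<Longrightarrow> vf_apply X (a *\<^sub>R f) = a *\<^sub>R vf_apply X f"
  by (simp add: vf_apply_def fun_eq_iff vf_scaleR)

lemma vf_apply_mult:
  "X \<in> vector_fields A \<Longrightarrow> f \<in> smooth_functions A \<Longrightarrow> h \<in> smooth_functions A \<Longrightarrow>
    vf_apply X (f * h) = f * vf_apply X h + vf_apply X f * h"
  by (simp add: vf_apply_def fun_eq_iff vf_leibniz)

lemma vf_apply_nonsmooth:
  "X \<in> vector_fields A \<Longrightarrow> f \<notin> smooth_functions A \<Longrightarrow> vf_apply X f = 0"
  by (simp add: vf_apply_def fun_eq_iff vf_nonsmooth)

lemma vf_zero: "X \<in> vector_fields A \<Longrightarrow> X p 0 = 0"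
  using vf_scaleR[of X 0 p 0] smooth_functions_zero by simp

lemma vector_fields_lie_bracket:
  assumes X: "X \<in> vector_fields A" and Y: "Y \<in> vector_fields A"
  shows "lie_bracket X Y \<in> vector_fields A"
proof -
  have "lie_bracket X Y p \<in> tangent_space A p" for p
    using X Y
    by (auto simp: tangent_space_def lie_bracket_def vf_apply_nonsmooth vf_zero vf_apply_add vf_add
        vf_apply_scaleR vf_scaleR vf_smooth vf_apply_vf_apply_leibniz algebra_simps)
  moreover have "vf_apply (lie_bracket X Y) f = vf_apply X (vf_apply Y f) - vf_apply Y (vf_apply X f)"
    for f by (simp add: lie_bracket_def vf_apply_def fun_eq_iff)
  ultimately show ?thesis
    using X Y by (auto simp: vector_fields_def intro: smooth_functions_diff)
qed

lemma lie_bracket_add_left: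
  "X \<in> vector_fields A \<Longrightarrow> X' \<in> vector_fields A \<Longrightarrow> Y \<in> vector_fields A \<Longrightarrow>
    lie_bracket (X + X') Y = lie_bracket X Y + lie_bracket X' Y"
proof (intro ext)
  fix p f
  assume *: "X \<in> vector_fields A" "X' \<in> vector_fields A" "Y \<in> vector_fields A"
  have "vf_apply (X + X') f = vf_apply X f + vf_apply X' f"
    by (simp add: vf_apply_def fun_eq_iff)
  then show "lie_bracket (X + X') Y p f = (lie_bracket X Y + lie_bracket X' Y) p f"
    using * by (cases "f \<in> smooth_functions A")
      (auto simp: lie_bracket_def vf_add vf_smooth vf_apply_nonsmooth vf_zero)
qed

lemma lie_bracket_swap: "lie_bracket Y X = - lie_bracket X Y"
  by (simp add: lie_bracket_def fun_eq_iff)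

lemma vf_apply_add_field: "vf_apply (X + Y) f = vf_apply X f + vf_apply Y f"
  by (simp add: vf_apply_def fun_eq_iff)

lemma vf_apply_mult_field: "vf_apply (vf_mult \<phi> X) f = \<phi> * vf_apply X f"
  by (simp add: vf_apply_def vf_mult_def fun_eq_iff)

lemma lie_bracket_mult_left:
  assumes "\<phi> \<in> smooth_functions A" "X \<in> vector_fields A" "Y \<in> vector_fields A"
  shows "lie_bracket (vf_mult \<phi> X) Y = vf_mult \<phi> (lie_bracket X Y) - vf_mult (vf_apply Y \<phi>) X"
proof (intro ext)
  fix p f
  have app: "vf_apply Z h q = Z q h" for Z :: "'a vfield" and h q
    by (simp add: vf_apply_def)
  have mult_app: "vf_mult \<psi> Z q h = \<psi> q * Z q h" for \<psi> and Z :: "'a vfield" and h q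
    by (simp add: vf_mult_def)
  show "lie_bracket (vf_mult \<phi> X) Y p f
      = (vf_mult \<phi> (lie_bracket X Y) - vf_mult (vf_apply Y \<phi>) X) p f"
    using assms
    by (cases "f \<in> smooth_functions A")
      (auto simp: lie_bracket_def vf_apply_mult_field vf_leibniz vf_smooth vf_apply_nonsmooth vf_zero
        mult_app vf_nonsmooth app algebra_simps)
qed

context
  fixes g :: "'a metric2"
  assumes g: "two_riemannian_metric A g"
begin

lemma metric_fun_smooth:
  "X \<in> vector_fields A \<Longrightarrow> Y \<in> vector_fields A \<Longrightarrow> Z \<in> vector_fields A \<Longrightarrow>
    metric_fun g X Y Z \<in> smooth_functions A"
  using g by (simp add: two_riemannian_metric_def)

lemma metric_fun_sym:
  assumes "X \<in> vector_fields A" "Y \<in> vector_fields A" "Z \<in> vector_fields A"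
  shows "metric_fun g X Y Z = metric_fun g Y X Z"
  using g assms
  by (auto simp: two_riemannian_metric_def two_inner_product_def metric_fun_def fun_eq_iff vf_tangent)

lemma metric_linear:
  assumes "X \<in> vector_fields A" "X' \<in> vector_fields A" "Y \<in> vector_fields A" "Z \<in> vector_fields A"
  shows "g p (a *\<^sub>R X p + X' p) (Y p) (Z p) = a * g p (X p) (Y p) (Z p) + g p (X' p) (Y p) (Z p)"
proof -
  have "two_inner_product (tangent_space A p) (g p)"
    using g by (simp add: two_riemannian_metric_def)
  then show ?thesis
    unfolding two_inner_product_def by (metis vf_tangent assms)
qed

lemma metric_fun_mult_add:
  assumes "X \<in> vector_fields A" "X' \<in> vector_fields A" "Y \<in> vector_fields A" "Z \<in> vector_fields A"
  shows "metric_fun g (vf_mult \<phi> X + X') Y Z = \<phi> * metric_fun g X Y Z + metric_fun g X' Y Z"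
  using assms by (simp add: metric_fun_def fun_eq_iff vf_mult_def metric_linear)

lemma vf_mult_1: "vf_mult (\<lambda>p. 1) X = X"
  by (simp add: vf_mult_const)

lemma vector_fields_zero: assumes "X \<in> vector_fields A" shows "0 \<in> vector_fields A"
  using vector_fields_scaleR[OF assms, of 0] by simp

lemma metric_fun_add:
  assumes "X \<in> vector_fields A" "X' \<in> vector_fields A" "Y \<in> vector_fields A" "Z \<in> vector_fields A"
  shows "metric_fun g (X + X') Y Z = metric_fun g X Y Z + metric_fun g X' Y Z"
  using metric_fun_mult_add[OF assms, of "\<lambda>p. 1"] by (simp add: vf_mult_1 fun_eq_iff)

lemma metric_fun_zero:
  assumes "Y \<in> vector_fields A" "Z \<in> vector_fields A"
  shows "metric_fun g 0 Y Z = 0"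
  using metric_fun_add[OF vector_fields_zero[OF assms(1)] vector_fields_zero[OF assms(1)] assms] by simp

lemma metric_fun_mult:
  assumes "X \<in> vector_fields A" "Y \<in> vector_fields A" "Z \<in> vector_fields A"
  shows "metric_fun g (vf_mult \<phi> X) Y Z = \<phi> * metric_fun g X Y Z"
  using metric_fun_mult_add[OF assms(1) vector_fields_zero[OF assms(2)] assms(2,3), of \<phi>]
    metric_fun_zero[OF assms(2,3)] by simp

lemma metric_fun_uminus:
  assumes "X \<in> vector_fields A" "Y \<in> vector_fields A" "Z \<in> vector_fields A"
  shows "metric_fun g (- X) Y Z = - metric_fun g X Y Z"
  using metric_fun_mult[OF assms, of "\<lambda>p. -1"] by (simp add: vf_mult_const fun_eq_iff)

lemma vector_fields_uminus: assumes "X \<in> vector_fields A" shows "- X \<in> vector_fields A"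
  using vector_fields_scaleR[OF assms, of "-1"] by simp

lemma metric_fun_diff:
  assumes "X \<in> vector_fields A" "X' \<in> vector_fields A" "Y \<in> vector_fields A" "Z \<in> vector_fields A"
  shows "metric_fun g (X - X') Y Z = metric_fun g X Y Z - metric_fun g X' Y Z"
  using metric_fun_add[OF assms(1) vector_fields_uminus[OF assms(2)] assms(3,4)]
    metric_fun_uminus[OF assms(2-4)] by simp

lemmas vf_intros = vector_fields_add vector_fields_mult vector_fields_lie_bracket
  vf_smooth metric_fun_smooth smooth_functions_add smooth_functions_mult

lemma metric_fun_add_right:
  assumes "X \<in> vector_fields A" "X' \<in> vector_fields A" "Y \<in> vector_fields A" "Z \<in> vector_fields A"
  shows "metric_fun g Y (X + X') Z = metric_fun g Y X Z + metric_fun g Y X' Z"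
  using metric_fun_add[OF assms] assms by (simp add: metric_fun_sym[of Y] vf_intros)

lemma metric_fun_mult_right:
  assumes "\<phi> \<in> smooth_functions A" "X \<in> vector_fields A" "Y \<in> vector_fields A" "Z \<in> vector_fields A"
  shows "metric_fun g Y (vf_mult \<phi> X) Z = \<phi> * metric_fun g Y X Z"
  using metric_fun_mult[OF assms(2-4)] assms by (simp add: metric_fun_sym[of Y] vf_intros)

lemma lie_bracket_add_right:
  assumes "X \<in> vector_fields A" "Y \<in> vector_fields A" "Y' \<in> vector_fields A"
  shows "lie_bracket X (Y + Y') = lie_bracket X Y + lie_bracket X Y'"
  using assms by (simp add: lie_bracket_swap[of X] lie_bracket_add_left)

lemma lie_bracket_mult_right:
  assumes "\<phi> \<in> smooth_functions A" "X \<in> vector_fields A" "Y \<in> vector_fields A"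
  shows "lie_bracket X (vf_mult \<phi> Y) = vf_mult (vf_apply X \<phi>) Y + vf_mult \<phi> (lie_bracket X Y)"
proof -
  have "vf_mult \<phi> (- Z) = - vf_mult \<phi> Z" for Z :: "'a vfield"
    by (simp add: vf_mult_def fun_eq_iff)
  then show ?thesis
    using assms by (simp add: lie_bracket_swap[of X] lie_bracket_mult_left)
qed

lemmas koszul_formula_simps = koszul_formula_def vf_intros vf_apply_add_field vf_apply_mult_field
  vf_apply_add vf_apply_mult metric_fun_add metric_fun_add_right metric_fun_mult
  metric_fun_mult_right metric_fun_diff lie_bracket_add_left lie_bracket_add_right
  lie_bracket_mult_left lie_bracket_mult_right

lemma koszul_formula_add:
  assumes "X \<in> vector_fields A" "X' \<in> vector_fields A"
    "Y \<in> vector_fields A" "Z \<in> vector_fields A" "W \<in> vector_fields A"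
  shows "koszul_formula A g (X + X') Y Z W = koszul_formula A g X Y Z W + koszul_formula A g X' Y Z W"
    and "koszul_formula A g Y (X + X') Z W = koszul_formula A g Y X Z W + koszul_formula A g Y X' Z W"
    and "koszul_formula A g Y Z (X + X') W = koszul_formula A g Y Z X W + koszul_formula A g Y Z X' W"
  using assms by (auto simp: koszul_formula_simps fun_eq_iff field_simps)

lemma koszul_formula_mult:
  assumes "\<phi> \<in> smooth_functions A" "X \<in> vector_fields A"
    "Y \<in> vector_fields A" "Z \<in> vector_fields A" "W \<in> vector_fields A"
  shows "koszul_formula A g (vf_mult \<phi> X) Y Z W = \<phi> * koszul_formula A g X Y Z W"
    and "koszul_formula A g X (vf_mult \<phi> Y) Z W = vf_apply X \<phi> * metric_fun g Y Z W + \<phi> * koszul_formula A g X Y Z W"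
    and "koszul_formula A g X Y (vf_mult \<phi> Z) W = \<phi> * koszul_formula A g X Y Z W"
  using assms metric_fun_sym[of X Y W] metric_fun_sym[of X Z W] metric_fun_sym[of Y Z W]
  by (auto simp: koszul_formula_simps fun_eq_iff field_simps)

lemma koszul_formula_outside: "Z \<notin> vector_fields A \<or> W \<notin> vector_fields A \<Longrightarrow> koszul_formula A g X Y Z W = 0"
  by (auto simp: koszul_formula_def)

lemma metric_hom_outside: "Y \<notin> vector_fields A \<or> Z \<notin> vector_fields A \<Longrightarrow> metric_hom A g X Y Z = 0"
  by (auto simp: metric_hom_def)

lemma metric_hom_inside:
  "Y \<in> vector_fields A \<Longrightarrow> Z \<in> vector_fields A \<Longrightarrow> metric_hom A g X Y Z = metric_fun g X Y Z"
  by (auto simp: metric_hom_def)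

lemma koszul_formula_D20:
  assumes "X \<in> vector_fields A" "Y \<in> vector_fields A" shows "koszul_formula A g X Y \<in> D20 A"
proof -
  have "koszul_formula A g X Y Z W \<in> smooth_functions A" if "Z \<in> vector_fields A" "W \<in> vector_fields A" for Z W
    using assms that
    by (simp add: koszul_formula_def smooth_functions_scaleR smooth_functions_diff vf_intros)
  then show ?thesis
    using assms by (auto simp: D20_def koszul_formula_outside koszul_formula_add koszul_formula_mult vector_fields_mult)
qed

lemma metric_hom_D20_hom: "D20_hom A (metric_hom A g)"
proof -
  have "metric_hom A g X \<in> D20 A" if "X \<in> vector_fields A" for X
    using that
    by (auto simp: D20_def metric_hom_outside metric_hom_inside metric_fun_smooth
        metric_fun_add_right metric_fun_mult_right vf_intros)
  then show ?thesis
    by (auto simp: D20_hom_def d_mult_def metric_hom_def metric_fun_add metric_fun_mult fun_eq_iff)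
qed

lemma koszul_formula_pseudoconnection: "pseudoconnection A (metric_hom A g) (koszul_formula A g)"
proof -
  have 1: "koszul_formula A g (a *\<^sub>R X + X') Y = a *\<^sub>R koszul_formula A g X Y + koszul_formula A g X' Y"
    if "X \<in> vector_fields A" "X' \<in> vector_fields A" "Y \<in> vector_fields A" for a X X' Y
  proof (intro ext)
    fix Z W p
    show "koszul_formula A g (a *\<^sub>R X + X') Y Z W p = (a *\<^sub>R koszul_formula A g X Y + koszul_formula A g X' Y) Z W p"
      using that koszul_formula_mult(1)[OF smooth_functions_const, of X Y Z W a]
      by (cases "Z \<in> vector_fields A \<and> W \<in> vector_fields A")
        (auto simp: koszul_formula_outside koszul_formula_add vector_fields_scaleR vf_mult_const)
  qed
  have 2: "koszul_formula A g X (a *\<^sub>R Y + Y') = a *\<^sub>R koszul_formula A g X Y + koszul_formula A g X Y'"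
    if "X \<in> vector_fields A" "Y \<in> vector_fields A" "Y' \<in> vector_fields A" for a X Y Y'
  proof (intro ext)
    fix Z W p
    have "vf_apply X (\<lambda>p. a) = 0"
    proof
      fix q
      have "(\<lambda>p::'a. 1::real) * (\<lambda>p. 1) = (\<lambda>p. 1)" "a *\<^sub>R (\<lambda>p::'a. 1) = (\<lambda>p. a)"
        by (simp_all add: fun_eq_iff)
      then have "X q (\<lambda>p. 1) = 0" "X q (\<lambda>p. a) = a * X q (\<lambda>p. 1)"
        using vf_leibniz[OF that(1) smooth_functions_const smooth_functions_const, of q 1 1]
          vf_scaleR[OF that(1) smooth_functions_const, of q a 1] by simp_all
      then show "vf_apply X (\<lambda>p. a) q = 0 q" by (simp add: vf_apply_def)
    qed
    then show "koszul_formula A g X (a *\<^sub>R Y + Y') Z W p = (a *\<^sub>R koszul_formula A g X Y + koszul_formula A g X Y') Z W p"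
      using that koszul_formula_mult(2)[OF smooth_functions_const, of X Y Z W a]
      by (cases "Z \<in> vector_fields A \<and> W \<in> vector_fields A")
        (auto simp: koszul_formula_outside koszul_formula_add vector_fields_scaleR vf_mult_const)
  qed
  have 3: "koszul_formula A g (vf_mult \<phi> X) Y = d_mult \<phi> (koszul_formula A g X Y) \<and>
      koszul_formula A g X (vf_mult \<phi> Y) = d_mult (vf_apply X \<phi>) (metric_hom A g Y) + d_mult \<phi> (koszul_formula A g X Y)"
    if "\<phi> \<in> smooth_functions A" "X \<in> vector_fields A" "Y \<in> vector_fields A" for \<phi> X Y
  proof (intro conjI ext)
    fix Z W p
    show "koszul_formula A g (vf_mult \<phi> X) Y Z W p = d_mult \<phi> (koszul_formula A g X Y) Z W p"
      using that by (cases "Z \<in> vector_fields A \<and> W \<in> vector_fields A")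
        (auto simp: koszul_formula_outside d_mult_def koszul_formula_mult)
    show "koszul_formula A g X (vf_mult \<phi> Y) Z W p
        = (d_mult (vf_apply X \<phi>) (metric_hom A g Y) + d_mult \<phi> (koszul_formula A g X Y)) Z W p"
      using that by (cases "Z \<in> vector_fields A \<and> W \<in> vector_fields A")
        (auto simp: koszul_formula_outside metric_hom_outside metric_hom_inside d_mult_def koszul_formula_mult)
  qed
  show ?thesis
    unfolding pseudoconnection_def using metric_hom_D20_hom koszul_formula_D20 1 2 3 by blast
qed

lemma koszul_formula_torsion_free: "torsion_free A (metric_hom A g) (koszul_formula A g)"
  unfolding torsion_free_def
proof (intro ballI ext)
  fix X Y Z W p assume XY: "X \<in> vector_fields A" "Y \<in> vector_fields A"
  show "(koszul_formula A g X Y - koszul_formula A g Y X) Z W p = metric_hom A g (lie_bracket X Y) Z W p"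
  proof (cases "Z \<in> vector_fields A \<and> W \<in> vector_fields A")
    case True
    then show ?thesis
      using XY metric_fun_sym[of X Y W] metric_fun_sym[of X Z W] metric_fun_sym[of Y Z W]
      by (auto simp: koszul_formula_def metric_hom_def lie_bracket_swap[of X Y]
          lie_bracket_swap[of X Z] lie_bracket_swap[of Y Z] metric_fun_uminus vf_intros
          vector_fields_uminus field_simps)
  qed (auto simp: koszul_formula_outside metric_hom_outside)
qed

lemma koszul_formula_compatible: "compatible A (metric_hom A g) (koszul_formula A g)"
  unfolding compatible_def
proof (intro ballI ext)
  fix X Y Z W p
  assume *: "X \<in> vector_fields A" "Y \<in> vector_fields A" "Z \<in> vector_fields A" "W \<in> vector_fields A"
  then show "vf_apply X (metric_hom A g Y Z W) p = (koszul_formula A g X Y Z W + koszul_formula A g X Z Y W) p"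
    using metric_fun_sym[of X Y W] metric_fun_sym[of X Z W] metric_fun_sym[of Y Z W]
    by (auto simp: koszul_formula_def metric_hom_def lie_bracket_swap[of X Y]
        lie_bracket_swap[of X Z] lie_bracket_swap[of Y Z] metric_fun_uminus vf_intros
        vector_fields_uminus field_simps)
qed

lemma two_riemannian_pseudoconnection_iff:
  "two_riemannian_pseudoconnection A g nabla \<longleftrightarrow>
    (\<forall>X\<in>vector_fields A. \<forall>Y\<in>vector_fields A. nabla X Y = koszul_formula A g X Y)"
proof (intro iffI ballI)
  fix X Y
  assume nabla: "two_riemannian_pseudoconnection A g nabla"
    and XY: "X \<in> vector_fields A" "Y \<in> vector_fields A"
  show "nabla X Y = koszul_formula A g X Y"
  proof (intro ext)
    fix Z W p
    show "nabla X Y Z W p = koszul_formula A g X Y Z W p"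
    proof (cases "Z \<in> vector_fields A \<and> W \<in> vector_fields A")
      case True
      have C: "vf_apply S (metric_fun g T R W) p = nabla S T R W p + nabla S R T W p"
        if "S \<in> vector_fields A" "T \<in> vector_fields A" "R \<in> vector_fields A" for S T R
      proof -
        have "vf_apply S (metric_hom A g T R W) = nabla S T R W + nabla S R T W"
          using nabla that True
          unfolding two_riemannian_pseudoconnection_def compatible_def by blast
        then show ?thesis
          using that True by (simp add: metric_hom_inside)
      qed
      have T: "metric_fun g (lie_bracket S T) R W p = nabla S T R W p - nabla T S R W p"
        if "S \<in> vector_fields A" "T \<in> vector_fields A" "R \<in> vector_fields A" for S T R
      proof -
        have "nabla S T - nabla T S = metric_hom A g (lie_bracket S T)"
          using nabla that
          unfolding two_riemannian_pseudoconnection_def torsion_free_def by blast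
        then have "metric_hom A g (lie_bracket S T) R W p = (nabla S T - nabla T S) R W p"
          by simp
        then show ?thesis
          using that True by (simp add: metric_hom_inside)
      qed
      show ?thesis
        using True XY by (simp add: koszul_formula_def C T)
    next
      case False
      have "nabla X Y \<in> D20 A"
        using nabla XY
        unfolding two_riemannian_pseudoconnection_def pseudoconnection_def by blast
      then show ?thesis
        using False by (auto simp: koszul_formula_outside D20_def)
    qed
  qed
next
  assume eq: "\<forall>X\<in>vector_fields A. \<forall>Y\<in>vector_fields A. nabla X Y = koszul_formula A g X Y"
  have [simp]: "a *\<^sub>R X + Y \<in> vector_fields A" if "X \<in> vector_fields A" "Y \<in> vector_fields A" for a X Y
    using that by (simp add: vector_fields_add vector_fields_scaleR)
  show "two_riemannian_pseudoconnection A g nabla"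
    using koszul_formula_pseudoconnection koszul_formula_torsion_free koszul_formula_compatible eq
    by (simp add: two_riemannian_pseudoconnection_def pseudoconnection_def torsion_free_def
        compatible_def vector_fields_mult)
qed

end

end

end

theory Submission
  imports Defs
begin

text \<open>
  In a 2-inner product $g(\cdot,w/w)=0$, so a Koszul derivative forces $\nabla^g_XX(W,W)=0$,
  which by the explicit formula says $W g(X,X/W) = 2 g([W,X],X/W)$ for all fields $X$, $W$.
  Replacing $W$ by $\varphi W$ and using $g(\cdot,\cdot/\varphi W)=\varphi^2 g(\cdot,\cdot/W)$
  leaves $\varphi^2\, W(\varphi)\, g(X,X/W) = 0$. This fails at any point where $X$ and $W$ are
  linearly independent, for a suitable $\varphi$; such fields are cut-off coordinate fields.
\<close>

section \<open>2-inner products\<close>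

text \<open>Since w is dependent on itself, g(w,w/w) = 0, so t -> g(tw+u, tw+u/w) has no quadratic
  term. It is affine with slope 2 g(u,w/w) and nonnegative for every t, which forces slope
  0.\<close>

lemma two_inner_product_same_right:
  assumes g: "two_inner_product V g" and V: "subspace V" and u: "u \<in> V" and w: "w \<in> V"
  shows "g u w w = 0"
proof (rule ccontr)
  assume nz: "g u w w \<noteq> 0"
  have lin: "g (a *\<^sub>R x + x') y z = a * g x y z + g x' y z"
    if "x \<in> V" "x' \<in> V" "y \<in> V" "z \<in> V" for a x x' y z
    using g that unfolding two_inner_product_def by blast
  have sym: "g x y z = g y x z" if "x \<in> V" "y \<in> V" "z \<in> V" for x y z
    using g that unfolding two_inner_product_def by blast
  have "lin_dep_pair w w"
    unfolding lin_dep_pair_def by (intro exI[of _ 1] exI[of _ "-1"]) simp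
  then have 0: "g w w w = 0"
    using g w unfolding two_inner_product_def by blast
  have q: "2 * t * g u w w + g u u w \<ge> 0" for t
  proof -
    let ?x = "t *\<^sub>R w + u"
    have x: "?x \<in> V" using V u w by (simp add: subspace_add subspace_scale)
    have "g ?x ?x w = t * g w ?x w + g u ?x w" using lin u w x by blast
    also have "g w ?x w = t * g w w w + g u w w"
      using sym[OF w x w] lin[OF w u w w] by simp
    also have "g u ?x w = t * g w u w + g u u w"
      using sym[OF u x w] lin[OF w u u w] by simp
    also have "g w u w = g u w w" using sym u w by blast
    finally have "g ?x ?x w = 2 * t * g u w w + g u u w" using 0 by simp
    moreover have "g ?x ?x w \<ge> 0" using g x w unfolding two_inner_product_def by blast
    ultimately show ?thesis by simp
  qed
  \<comment> \<open>This t is the parameter at which the affine function takes the value -1.\<close>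
  have "2 * (- (g u u w + 1) / (2 * g u w w)) * g u w w + g u u w = -1"
    using nz by (simp add: field_simps)
  with q[of "- (g u u w + 1) / (2 * g u w w)"] show False by simp
qed

text \<open>The axioms give no linearity in the third argument. For u = v the swap g(u,u/w) =
  g(w,w/u) moves w into the two linear arguments, which yields the square of a; polarization then
  covers u and v distinct.\<close>

lemma two_inner_product_scale_right:
  assumes g: "two_inner_product V g" and V: "subspace V"
    and u: "u \<in> V" and v: "v \<in> V" and w: "w \<in> V"
  shows "g u v (a *\<^sub>R w) = a * a * g u v w"
proof -
  have lin: "g (b *\<^sub>R x + x') y z = b * g x y z + g x' y z"
    if "x \<in> V" "x' \<in> V" "y \<in> V" "z \<in> V" for b x x' y z
    using g that unfolding two_inner_product_def by blast
  have sym: "g x y z = g y x z" if "x \<in> V" "y \<in> V" "z \<in> V" for x y z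
    using g that unfolding two_inner_product_def by blast
  have swap: "g x x y = g y y x" if "x \<in> V" "y \<in> V" for x y
    using g that unfolding two_inner_product_def by blast
  \<comment> \<open>The factor 1 keeps the sum in the shape of the linearity axiom, which is stated
    for a scaled vector plus a vector.\<close>
  have aw: "a *\<^sub>R w \<in> V" and uv: "1 *\<^sub>R u + v \<in> V" and zero: "0 \<in> V"
    using V u v w by (simp_all add: subspace_add subspace_scale subspace_0)
  have zero_left: "g 0 y z = 0" if "y \<in> V" "z \<in> V" for y z
    using lin[OF zero zero that, of 1] by simp
  have scale: "g (a *\<^sub>R w) y z = a * g w y z" if "y \<in> V" "z \<in> V" for y z
    using lin[OF w zero that, of a] zero_left that by simp
  have diag: "g x x (a *\<^sub>R w) = a * a * g x x w" if x: "x \<in> V" for x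
    using swap[OF x aw] scale[OF aw x] sym[OF w aw x] scale[OF w x] swap[OF x w] by simp
  have polar: "g (1 *\<^sub>R u + v) (1 *\<^sub>R u + v) z = g u u z + 2 * g u v z + g v v z" if z: "z \<in> V" for z
    using lin[OF u v uv z, of 1] lin[OF u v u z, of 1] lin[OF u v v z, of 1]
      sym[OF u uv z] sym[OF v uv z] sym[OF u v z] by simp
  show ?thesis
    using polar[OF w] polar[OF aw] diag[OF u] diag[OF v] diag[OF uv] by (simp add: algebra_simps)
qed


section \<open>Calculus of smooth functions\<close>

lemma Ck_on_subset: "Ck_on k f S \<Longrightarrow> T \<subseteq> S \<Longrightarrow> Ck_on k f T"
  by (induction k arbitrary: f) (auto intro: continuous_on_subset)

text \<open>Derivatives are taken \<open>at x\<close> in the whole space, so differentiability is a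
  pointwise condition; openness enters through continuity in the base case.\<close>

lemma Ck_on_Un:
  assumes "open S" "open T" "Ck_on k f S" "Ck_on k f T"
  shows "Ck_on k f (S \<union> T)"
  using assms(3,4)
proof (induction k arbitrary: f)
  case 0
  then show ?case using assms(1,2) by (simp add: continuous_on_open_Un)
qed auto

lemma frechet_derivative_bounded_linear:
  "bounded_linear f \<Longrightarrow> frechet_derivative f (at x) = f"
  by (metis bounded_linear_imp_has_derivative frechet_derivative_at)

lemma Ck_on_bounded_linear:
  assumes "bounded_linear f" shows "Ck_on k f S"
proof (cases k)
  case 0
  then show ?thesis using assms by (simp add: linear_continuous_on)
next
  case (Suc k)
  then show ?thesis
    using assms
    by (simp add: frechet_derivative_bounded_linear Ck_on_const bounded_linear_imp_differentiable)
qed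

lemma Ck_on_inner_diff: "Ck_on k (\<lambda>x. (x - a) \<bullet> b) UNIV"
  using Ck_on_add[OF open_UNIV Ck_on_bounded_linear[OF bounded_linear_inner_left] Ck_on_const, of k b "- (a \<bullet> b)"]
  by (simp add: inner_diff_left)

lemma Ck_on_bounded_linear_compose:
  assumes L: "bounded_linear L" and "open S" "Ck_on k h S"
  shows "Ck_on k (\<lambda>x. L (h x)) S"
  using assms(3)
proof (induction k arbitrary: h)
  case 0
  then show ?case using L by (simp add: bounded_linear.continuous_on)
next
  case (Suc k)
  have D: "((\<lambda>x. L (h x)) has_derivative (\<lambda>v. L (frechet_derivative h (at x) v))) (at x)"
    if "x \<in> S" for x
    using Suc.prems that
    by (intro bounded_linear.has_derivative[OF L]) (simp add: frechet_derivative_works)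
  have "Ck_on k (\<lambda>x. frechet_derivative (\<lambda>x. L (h x)) (at x) v) S" for v
  proof (rule Ck_on_cong[OF \<open>open S\<close>])
    show "Ck_on k (\<lambda>x. L (frechet_derivative h (at x) v)) S"
      using Suc by simp
    show "L (frechet_derivative h (at x) v) = frechet_derivative (\<lambda>x. L (h x)) (at x) v"
      if "x \<in> S" for x
      using frechet_derivative_at[OF D[OF that]] by metis
  qed
  then show ?case using D by (auto simp: differentiable_def)
qed

lemma Ck_on_sum:
  assumes "open S" "finite I" "\<And>i. i \<in> I \<Longrightarrow> Ck_on k (f i) S"
  shows "Ck_on k (\<lambda>x. \<Sum>i\<in>I. f i x) S"
  using assms(2,3)
  by (induction I rule: finite_induct) (simp_all add: Ck_on_const Ck_on_add[OF assms(1)])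

text \<open>In the chain rule the direction fed to the derivative of f varies with x, whereas
  \<open>Ck_on\<close> controls derivatives in fixed directions only. Expanding that direction in
  \<open>Basis\<close> gives a sum of products to which the induction hypothesis applies.\<close>

lemma Ck_on_compose:
  fixes f :: "'b::euclidean_space \<Rightarrow> real" and h :: "'a::euclidean_space \<Rightarrow> 'b"
  assumes "open S" "open T" "h ` S \<subseteq> T" "Ck_on k h S" "Ck_on k f T"
  shows "Ck_on k (\<lambda>x. f (h x)) S"
  using assms(4,5)
proof (induction k arbitrary: f)
  case 0
  then show ?case using assms(3) by (auto intro: continuous_on_compose2)
next
  case (Suc k)
  have Df: "(f has_derivative frechet_derivative f (at (h x))) (at (h x))"
    and Dh: "(h has_derivative frechet_derivative h (at x)) (at x)" if "x \<in> S" for x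
    using Suc.prems assms(3) that by (auto simp: frechet_derivative_works[symmetric])
  have D: "((\<lambda>x. f (h x)) has_derivative
      (\<lambda>v. frechet_derivative f (at (h x)) (frechet_derivative h (at x) v))) (at x)"
    if "x \<in> S" for x
    using has_derivative_compose[OF Dh[OF that] Df[OF that]] .
  have "Ck_on k (\<lambda>x. frechet_derivative (\<lambda>x. f (h x)) (at x) v) S" for v
  proof (rule Ck_on_cong[OF assms(1)])
    have "Ck_on k (\<lambda>x. frechet_derivative f (at (h x)) b) S" for b
      by (rule Suc.IH) (use Suc.prems in \<open>auto intro: Ck_on_Suc_D simp del: Ck_on.simps\<close>, simp)
    moreover have "Ck_on k (\<lambda>x. frechet_derivative h (at x) v \<bullet> b) S" for b
      using Suc.prems by (intro Ck_on_bounded_linear_compose[OF bounded_linear_inner_left assms(1)]) simp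
    ultimately show "Ck_on k (\<lambda>x. \<Sum>b\<in>Basis. (frechet_derivative h (at x) v \<bullet> b)
        * frechet_derivative f (at (h x)) b) S"
      by (intro Ck_on_sum[OF assms(1) finite_Basis] Ck_on_mult[OF assms(1)])
    show "(\<Sum>b\<in>Basis. (frechet_derivative h (at x) v \<bullet> b) * frechet_derivative f (at (h x)) b)
        = frechet_derivative (\<lambda>x. f (h x)) (at x) v" if "x \<in> S" for x
    proof -
      have lin: "linear (frechet_derivative f (at (h x)))"
        using Df[OF that] has_derivative_linear by blast
      have "frechet_derivative (\<lambda>x. f (h x)) (at x) v
          = frechet_derivative f (at (h x)) (frechet_derivative h (at x) v)"
        using frechet_derivative_at[OF D[OF that]] by metis
      also have "\<dots> = (\<Sum>b\<in>Basis. (frechet_derivative h (at x) v \<bullet> b)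
          * frechet_derivative f (at (h x)) b)"
        by (subst (1) euclidean_representation[of "frechet_derivative h (at x) v", symmetric])
          (simp only: linear_sum[OF lin] linear_scale[OF lin] real_scaleR_def)
      finally show ?thesis by simp
    qed
  qed
  then show ?case using D by (auto simp: differentiable_def)
qed


section \<open>Bump functions\<close>

text \<open>\<open>flat 0\<close> is the classical smooth function that is flat at 0. The divisors
  \<open>t ^ n\<close> make the family closed under differentiation up to linear combinations, so
  one induction on the order of differentiability treats all n at once.\<close>

definition flat :: "nat \<Rightarrow> real \<Rightarrow> real"
  where "flat n t = (if t > 0 then exp (- 1 / t) / t ^ n else 0)"

text \<open>From the right, substituting t = 1/x turns the claim into the decay of x^n / exp x at
  infinity.\<close>

lemma flat_tendsto_0: "(flat n \<longlongrightarrow> 0) (at 0)"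
proof (rule filterlim_split_at)
  show "(flat n \<longlongrightarrow> 0) (at_left 0)"
    by (rule tendsto_eventually) (auto simp: flat_def eventually_at_filter)
  have "((\<lambda>x::real. x ^ n / exp x) \<longlongrightarrow> 0) at_top"
    by (rule tendsto_power_div_exp_0)
  then have "((\<lambda>x. flat n (inverse x)) \<longlongrightarrow> 0) at_top"
    by (rule Lim_transform_eventually)
      (auto simp: flat_def exp_minus field_simps intro!: eventually_mono[OF eventually_gt_at_top[of 0]])
  then show "(flat n \<longlongrightarrow> 0) (at_right 0)"
    by (simp add: filterlim_at_right_to_top)
qed

lemma flat_has_real_derivative:
  "(flat n has_real_derivative flat (n + 2) t - n * flat (n + 1) t) (at t)"
proof -
  consider "t > 0" | "t < 0" | "t = 0" by linarith
  then show ?thesis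
  proof cases
    case 1
    have "((\<lambda>t. exp (- 1 / t)) has_real_derivative exp (- 1 / t) / t\<^sup>2) (at t)"
      using 1 by (auto intro!: derivative_eq_intros simp: power2_eq_square)
    \<comment> \<open>Writing the derivative as a quotient by t avoids the truncated exponent n - 1
      when n = 0.\<close>
    moreover have "((\<lambda>t. t ^ n) has_real_derivative n * t ^ n / t) (at t)"
      using 1 DERIV_pow[of n t] by (cases n) auto
    ultimately have "((\<lambda>t. exp (- 1 / t) / t ^ n) has_real_derivative
        (exp (- 1 / t) / t\<^sup>2 * t ^ n - exp (- 1 / t) * (n * t ^ n / t)) / (t ^ n * t ^ n)) (at t)"
      by (rule DERIV_divide) (use 1 in simp)
    also have "(exp (- 1 / t) / t\<^sup>2 * t ^ n - exp (- 1 / t) * (n * t ^ n / t)) / (t ^ n * t ^ n)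
        = flat (n + 2) t - n * flat (n + 1) t"
      using 1 by (simp add: flat_def power_add power2_eq_square divide_simps) (simp add: algebra_simps)
    finally have "((\<lambda>t. exp (- 1 / t) / t ^ n) has_real_derivative
        flat (n + 2) t - n * flat (n + 1) t) (at t)" .
    then show ?thesis
      by (rule has_field_derivative_transform_within_open[of _ _ _ "{0<..}"])
        (use 1 in \<open>auto simp: flat_def\<close>)
  next
    case 2
    have "((\<lambda>t. 0) has_real_derivative flat (n + 2) t - n * flat (n + 1) t) (at t)"
      using 2 by (simp add: flat_def)
    then show ?thesis
      by (rule has_field_derivative_transform_within_open[of _ _ _ "{..<0}"])
        (use 2 in \<open>auto simp: flat_def\<close>)
  next
    case 3
    \<comment> \<open>Away from 0 this difference quotient is exactly
      \<open>flat (Suc n) y\<close>.\<close>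
    have "((\<lambda>y. (flat n y - flat n 0) / (y - 0)) \<longlongrightarrow> 0) (at 0)"
      by (rule Lim_transform_eventually[OF flat_tendsto_0[of "Suc n"]])
        (auto simp: flat_def eventually_at_filter)
    then show ?thesis
      using 3 by (simp add: has_field_derivative_iff flat_def)
  qed
qed

lemma Ck_on_flat: "Ck_on k (flat n) UNIV"
proof (induction k arbitrary: n)
  case 0
  show ?case
    using flat_has_real_derivative by (auto intro!: DERIV_continuous_on)
next
  case (Suc k)
  have "frechet_derivative (flat n) (at t) = (\<lambda>v. (flat (n + 2) t - n * flat (n + 1) t) * v)" for t
    using flat_has_real_derivative[of n t]
    by (metis has_field_derivative_def frechet_derivative_at)
  moreover have "Ck_on k (\<lambda>t. (flat (n + 2) t + - real n * flat (n + 1) t) * v) UNIV" for v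
    by (intro Ck_on_mult Ck_on_add Ck_on_const Suc open_UNIV)
  moreover have "flat n differentiable at t" for t
    using flat_has_real_derivative real_differentiable_def by blast
  ultimately show ?case by simp
qed

text \<open>\<open>flat 0\<close> is composed with r^2 - |x - a|^2, which is positive at a and
  negative off the closed ball. Writing the squared norm as a sum over coordinates makes its
  smoothness a matter of sums and products.\<close>

lemma ex_bump:
  fixes a :: "'e::euclidean_space"
  assumes "r > 0"
  obtains \<rho> :: "'e \<Rightarrow> real" where
    "\<And>k. Ck_on k \<rho> UNIV" "\<rho> a \<noteq> 0" "\<And>x. x \<notin> cball a r \<Longrightarrow> \<rho> x = 0"
proof
  let ?\<rho> = "\<lambda>x. flat 0 (r * r + - ((x - a) \<bullet> (x - a)))"
  have "Ck_on k (\<lambda>x. \<Sum>b\<in>Basis. ((x - a) \<bullet> b) * ((x - a) \<bullet> b)) UNIV" for k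
    by (intro Ck_on_sum Ck_on_mult Ck_on_inner_diff open_UNIV finite_Basis)
  then have sq: "Ck_on k (\<lambda>x. (x - a) \<bullet> (x - a)) UNIV" for k
    by (simp add: euclidean_inner[of "x - a" "x - a" for x])
  have "Ck_on k (\<lambda>x. r * r + - ((x - a) \<bullet> (x - a))) UNIV" for k
    using Ck_on_add[OF open_UNIV Ck_on_const[of k "r * r"] Ck_on_mult[OF open_UNIV Ck_on_const[of k "-1"] sq]]
    by simp
  then show "Ck_on k ?\<rho> UNIV" for k
    using Ck_on_compose[OF open_UNIV open_UNIV subset_UNIV _ Ck_on_flat] by fast
  show "?\<rho> a \<noteq> 0" using assms by (simp add: flat_def)
  show "?\<rho> x = 0" if "x \<notin> cball a r" for x
  proof -
    have "r < norm (x - a)" using that by (simp add: dist_norm norm_minus_commute)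
    then have "r * r < norm (x - a) * norm (x - a)" using assms by (intro mult_strict_mono) auto
    then show ?thesis by (simp add: flat_def power2_norm_eq_inner[symmetric] power2_eq_square)
  qed
qed


section \<open>Local vector fields\<close>

context
  fixes A :: "('a::{t2_space, second_countable_topology}, 'e::euclidean_space) chart set"
  assumes A: "smooth_manifold A"
begin

text \<open>In a Hausdorff space the preimage of K in U is compact, hence closed. So U and the
  complement of that preimage form an open cover: on U the extension is h in coordinates, on the
  complement it is 0.\<close>

lemma smooth_functions_extend:
  assumes c: "(U, \<phi>) \<in> A" and h: "smooth_on h (\<phi> ` U)"
    and K: "compact K" "K \<subseteq> \<phi> ` U" and h0: "\<And>x. x \<notin> K \<Longrightarrow> h x = 0"
  shows "(\<lambda>q. if q \<in> U then h (\<phi> q) else 0) \<in> smooth_functions A" (is "?F \<in> _")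
  unfolding smooth_functions_def smooth_on_def
proof (clarify)
  fix V \<psi> k
  assume d: "(V, \<psi>) \<in> A"
  define i where "i = inv_into V \<psi>"
  have cU: "open U" "open (\<phi> ` U)" "homeomorphism U (\<phi> ` U) \<phi> (inv_into U \<phi>)"
    and cV: "open V" "open (\<psi> ` V)" "homeomorphism V (\<psi> ` V) \<psi> i"
    using A c d by (auto simp: smooth_manifold_def is_chart_def i_def)
  have op: "open (\<psi> ` (V \<inter> T))" if "open T" for T
  proof -
    have "openin (top_of_set (\<psi> ` V)) (\<psi> ` (V \<inter> T))"
      using homeomorphism_imp_open_map[OF cV(3)] that by (simp add: openin_open_Int)
    then show ?thesis using cV(2) openin_open_trans by blast
  qed
  let ?L = "inv_into U \<phi> ` K"
  have "compact ?L"
    using cU(3) K by (meson compact_continuous_image continuous_on_subset homeomorphism_cont2)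
  then have cl: "closed ?L" by (rule compact_imp_closed)
  have iV: "i (\<psi> q) = q" if "q \<in> V" for q
    using cV(3) that by (simp add: homeomorphism_apply1)
  have iU: "inv_into U \<phi> (\<phi> q) = q" if "q \<in> U" for q
    using cU(3) that by (simp add: homeomorphism_apply1)
  let ?S = "\<psi> ` (V \<inter> U)" and ?T = "\<psi> ` (V \<inter> - ?L)"
  have "Ck_on k (?F \<circ> i) ?S"
  proof (rule Ck_on_cong[OF op[OF cU(1)]])
    \<comment> \<open>On the overlap the extension, read in the second chart, is h after the
      transition map.\<close>
    have "smooth_on (\<phi> \<circ> i) ?S"
      using A c d unfolding smooth_manifold_def i_def by blast
    then show "Ck_on k (\<lambda>x. h ((\<phi> \<circ> i) x)) ?S"
      using h iV
      by (intro Ck_on_compose[of _ "\<phi> ` U" "\<phi> \<circ> i" k h] op cU(1,2)) (auto simp: smooth_on_def)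
  qed (auto simp: iV)
  moreover have "Ck_on k (?F \<circ> i) ?T"
  proof (rule Ck_on_cong[OF op _ Ck_on_const[of _ 0]])
    show "open (- ?L)" using cl by auto
    fix x assume "x \<in> ?T"
    then obtain q where "x = \<psi> q" "q \<in> V" "q \<notin> ?L" by auto
    \<comment> \<open>A point q of U outside \<open>?L\<close> has coordinates outside K, because
      \<open>inv_into U \<phi>\<close> undoes \<open>\<phi>\<close> at q.\<close>
    then show "0 = (?F \<circ> i) x"
      using h0[of "\<phi> q"] iU[of q] iV[of q] by force
  qed
  ultimately have "Ck_on k (?F \<circ> i) (?S \<union> ?T)"
    by (intro Ck_on_Un op cU(1) open_Compl cl)
  moreover have "?L \<subseteq> U" by (intro image_subsetI inv_into_into subsetD[OF K(2)])
  then have "V = (V \<inter> U) \<union> (V \<inter> - ?L)" by blast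
  then have "?S \<union> ?T = \<psi> ` V" by (metis image_Un)
  ultimately show "Ck_on k (?F \<circ> inv_into V \<psi>) (\<psi> ` V)" by (simp add: i_def)
qed

text \<open>This is the coordinate derivation in direction b, cut off by \<open>\<rho>\<close>. The
  value 0 on non-smooth f is the convention of \<open>tangent_space\<close>.\<close>

definition local_field :: "'a set \<Rightarrow> ('a \<Rightarrow> 'e) \<Rightarrow> ('e \<Rightarrow> real) \<Rightarrow> 'e \<Rightarrow> 'a vfield"
  where "local_field U \<phi> \<rho> b = (\<lambda>q f. if q \<in> U \<and> f \<in> smooth_functions A
    then \<rho> (\<phi> q) * frechet_derivative (f \<circ> inv_into U \<phi>) (at (\<phi> q)) b else 0)"

text \<open>The derivation laws are the sum, scaling and product rules at the coordinate point.
  Smoothness of the field applied to f follows from \<open>smooth_functions_extend\<close>, as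
  \<open>\<rho>\<close> vanishes off K.\<close>

lemma local_field_vector_field:
  assumes c: "(U, \<phi>) \<in> A" and \<rho>: "\<And>k. Ck_on k \<rho> UNIV"
    and K: "compact K" "K \<subseteq> \<phi> ` U" and \<rho>0: "\<And>x. x \<notin> K \<Longrightarrow> \<rho> x = 0"
  shows "local_field U \<phi> \<rho> b \<in> vector_fields A"
  unfolding vector_fields_def
proof (intro CollectI conjI allI ballI)
  fix p
  let ?i = "inv_into U \<phi>"
  have D: "((f \<circ> ?i) has_derivative frechet_derivative (f \<circ> ?i) (at (\<phi> p))) (at (\<phi> p))"
    if "f \<in> smooth_functions A" "p \<in> U" for f
  proof -
    have "Ck_on (Suc 0) (f \<circ> ?i) (\<phi> ` U)"
      using that c unfolding smooth_functions_def smooth_on_def by blast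
    then show ?thesis using that(2) by (simp add: frechet_derivative_works[symmetric])
  qed
  have inv: "?i (\<phi> p) = p" if "p \<in> U"
    using A c that by (auto simp: smooth_manifold_def is_chart_def homeomorphism_apply1)
  have add: "frechet_derivative ((f + h) \<circ> ?i) (at (\<phi> p)) b
      = frechet_derivative (f \<circ> ?i) (at (\<phi> p)) b + frechet_derivative (h \<circ> ?i) (at (\<phi> p)) b"
    if "f \<in> smooth_functions A" "h \<in> smooth_functions A" "p \<in> U" for f h
  proof -
    have "(f + h) \<circ> ?i = (\<lambda>x. (f \<circ> ?i) x + (h \<circ> ?i) x)" by auto
    then show ?thesis
      using fun_cong[OF frechet_derivative_at[OF has_derivative_add[OF D[OF that(1,3)] D[OF that(2,3)]]], of b]
      by simp
  qed
  have scale: "frechet_derivative ((a *\<^sub>R f) \<circ> ?i) (at (\<phi> p)) b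
      = a * frechet_derivative (f \<circ> ?i) (at (\<phi> p)) b"
    if "f \<in> smooth_functions A" "p \<in> U" for f a
  proof -
    have "(a *\<^sub>R f) \<circ> ?i = (\<lambda>x. a *\<^sub>R (f \<circ> ?i) x)" by auto
    then show ?thesis
      using fun_cong[OF frechet_derivative_at[OF has_derivative_scaleR_right[OF D[OF that], of a]], of b]
      by simp
  qed
  have mult: "frechet_derivative ((f * h) \<circ> ?i) (at (\<phi> p)) b
      = f p * frechet_derivative (h \<circ> ?i) (at (\<phi> p)) b + frechet_derivative (f \<circ> ?i) (at (\<phi> p)) b * h p"
    if "f \<in> smooth_functions A" "h \<in> smooth_functions A" "p \<in> U" for f h
  proof -
    have "(f * h) \<circ> ?i = (\<lambda>x. (f \<circ> ?i) x * (h \<circ> ?i) x)" by auto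
    then show ?thesis
      using fun_cong[OF frechet_derivative_at[OF has_derivative_mult[OF D[OF that(1,3)] D[OF that(2,3)]]], of b]
        inv that(3) by simp
  qed
  show "local_field U \<phi> \<rho> b p \<in> tangent_space A p"
    using smooth_functions_add[OF A] smooth_functions_mult[OF A] smooth_functions_scaleR[OF A]
    by (cases "p \<in> U") (auto simp: tangent_space_def local_field_def add scale mult algebra_simps)
next
  fix f assume f: "f \<in> smooth_functions A"
  define h where "h = (\<lambda>x. \<rho> x * frechet_derivative (f \<circ> inv_into U \<phi>) (at x) b)"
  \<comment> \<open>One order is lost to the derivative appearing in h.\<close>
  have "Ck_on (Suc k) (f \<circ> inv_into U \<phi>) (\<phi> ` U)" for k
    using f c unfolding smooth_functions_def smooth_on_def by blast
  then have "smooth_on h (\<phi> ` U)"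
    unfolding smooth_on_def h_def
    by (intro allI Ck_on_mult chart_open[OF A c] Ck_on_subset[OF \<rho>]) auto
  then have "(\<lambda>q. if q \<in> U then h (\<phi> q) else 0) \<in> smooth_functions A"
    by (rule smooth_functions_extend[OF c _ K]) (simp add: h_def \<rho>0)
  moreover have "vf_apply (local_field U \<phi> \<rho> b) f = (\<lambda>q. if q \<in> U then h (\<phi> q) else 0)"
    using f by (simp add: vf_apply_def local_field_def h_def fun_eq_iff)
  ultimately show "vf_apply (local_field U \<phi> \<rho> b) f \<in> smooth_functions A" by simp
qed

text \<open>Cut-off coordinate fields in two distinct basis directions are tested on cut-off
  coordinate functions. At the centre the resulting matrix is the square of \<open>\<rho> ?a\<close>
  times the identity.\<close>

lemma ex_independent_vector_fields:
  assumes "DIM('e) \<ge> 2"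
  obtains X Y p where "X \<in> vector_fields A" "Y \<in> vector_fields A" "\<not> lin_dep_pair (X p) (Y p)"
proof -
  \<comment> \<open>The manifold is a whole type, hence nonempty, and any point serves.\<close>
  fix p0 :: 'a
  obtain U \<phi> where c: "(U, \<phi>) \<in> A" and p: "p0 \<in> U"
    using A unfolding smooth_manifold_def by blast
  let ?a = "\<phi> p0" and ?i = "inv_into U \<phi>"
  have op: "open (\<phi> ` U)" using chart_open[OF A c] .
  then obtain r where r: "r > 0" "cball ?a r \<subseteq> \<phi> ` U"
    using p open_contains_cball by (metis imageI)
  obtain \<rho> :: "'e \<Rightarrow> real" where \<rho>: "\<And>k. Ck_on k \<rho> UNIV" "\<rho> ?a \<noteq> 0"
    "\<And>x. x \<notin> cball ?a r \<Longrightarrow> \<rho> x = 0"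
    using ex_bump[OF r(1), of ?a] by metis
  define X where "X = local_field U \<phi> \<rho>"
  have XV: "X b \<in> vector_fields A" for b
    unfolding X_def by (rule local_field_vector_field[OF c \<rho>(1) compact_cball r(2) \<rho>(3)])
  have inj: "\<phi> (?i x) = x \<and> ?i x \<in> U" if "x \<in> \<phi> ` U" for x
    using that by (simp add: f_inv_into_f inv_into_into)
  \<comment> \<open>The coordinate is centred at \<open>?a\<close>, so in the product rule there the
    term with the derivative of \<open>\<rho>\<close> drops out.\<close>
  define f where "f = (\<lambda>e q. if q \<in> U then \<rho> (\<phi> q) * ((\<phi> q - ?a) \<bullet> e) else 0)"
  have f: "f e \<in> smooth_functions A" for e
    unfolding f_def
  proof (rule smooth_functions_extend[OF c _ compact_cball r(2)])
    show "smooth_on (\<lambda>x. \<rho> x * ((x - ?a) \<bullet> e)) (\<phi> ` U)"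
      unfolding smooth_on_def
      by (intro allI Ck_on_mult op Ck_on_subset[OF \<rho>(1)] Ck_on_subset[OF Ck_on_inner_diff]) auto
  qed (simp add: \<rho>(3))
  have Xf: "X b p0 (f e) = \<rho> ?a * \<rho> ?a * (b \<bullet> e)" for b e
  proof -
    have "Ck_on (Suc 0) \<rho> UNIV" using \<rho>(1) .
    then have "(\<rho> has_derivative frechet_derivative \<rho> (at ?a)) (at ?a)"
      by (simp add: frechet_derivative_works[symmetric])
    moreover have "((\<lambda>x. (x - ?a) \<bullet> e) has_derivative (\<lambda>v. v \<bullet> e)) (at ?a)"
      by (auto intro!: derivative_eq_intros)
    ultimately have "((\<lambda>x. \<rho> x * ((x - ?a) \<bullet> e)) has_derivative (\<lambda>v. \<rho> ?a * (v \<bullet> e))) (at ?a)"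
      using has_derivative_mult by fastforce
    then have "((f e \<circ> ?i) has_derivative (\<lambda>v. \<rho> ?a * (v \<bullet> e))) (at ?a)"
      by (rule has_derivative_transform_within_open[OF _ op])
        (use p inj in \<open>auto simp: f_def\<close>)
    from frechet_derivative_at[OF this]
    have "frechet_derivative (f e \<circ> ?i) (at ?a) b = \<rho> ?a * (b \<bullet> e)" by metis
    then show ?thesis using p f by (simp add: X_def local_field_def)
  qed
  obtain b e :: 'e where be: "b \<in> Basis" "e \<in> Basis" "b \<noteq> e"
    using assms by (metis numeral_2_eq_2 card_le_Suc0_iff_eq finite_Basis not_less_eq_eq)
  have "\<not> lin_dep_pair (X b p0) (X e p0)"
  proof
    assume "lin_dep_pair (X b p0) (X e p0)"
    then obtain s t where st: "s \<noteq> 0 \<or> t \<noteq> 0" "s *\<^sub>R X b p0 + t *\<^sub>R X e p0 = 0"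
      unfolding lin_dep_pair_def by blast
    have "s * X b p0 h + t * X e p0 h = 0" for h
      using fun_cong[OF st(2), of h] by simp
    \<comment> \<open>Evaluating on \<open>f b\<close> isolates s and on \<open>f e\<close> isolates
      t, by orthonormality of b and e.\<close>
    from this[of "f b"] this[of "f e"] show False
      using st(1) be \<rho>(2) by (simp add: Xf inner_Basis)
  qed
  then show thesis using that XV by blast
qed

section \<open>Derivations on constants, and rescaling factors with nonzero value and
  derivative\<close>

text \<open>The Leibniz rule for 1 * 1 = 1 gives X(1) = 2 X(1).\<close>

lemma vf_const:
  assumes "X \<in> vector_fields A"
  shows "X p (\<lambda>q. c) = 0"
proof -
  have "(\<lambda>q::'a. 1::real) * (\<lambda>q. 1) = (\<lambda>q. 1)" "c *\<^sub>R (\<lambda>q::'a. 1) = (\<lambda>q. c)"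
    by (simp_all add: fun_eq_iff)
  then show ?thesis
    using vf_leibniz[OF A assms smooth_functions_const smooth_functions_const, of p 1 1]
      vf_scaleR[OF A assms smooth_functions_const, of p c 1] by simp
qed

text \<open>If f has nonzero derivative along X p but vanishes at p, then f + 1 has the same
  derivative and the value 1 at p.\<close>

lemma ex_smooth_function_nonzero:
  assumes X: "X \<in> vector_fields A" and "X p \<noteq> 0"
  obtains \<phi> where "\<phi> \<in> smooth_functions A" "\<phi> p \<noteq> 0" "X p \<phi> \<noteq> 0"
proof -
  obtain f where f: "X p f \<noteq> 0" using assms by (auto simp: fun_eq_iff)
  then have fs: "f \<in> smooth_functions A" using vf_nonsmooth[OF A X] by blast
  let ?h = "f + (\<lambda>q. 1)"
  have "?h \<in> smooth_functions A" "X p ?h \<noteq> 0"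
    using f fs by (simp_all add: smooth_functions_add[OF A] smooth_functions_const vf_add[OF A X] vf_const[OF X])
  then show thesis using that f fs by (cases "f p = 0") auto
qed


section \<open>Rescaling the third argument\<close>

context
  fixes g :: "'a metric2"
  assumes g: "two_riemannian_metric A g"
begin

lemma two_inner_product_at: "two_inner_product (tangent_space A p) (g p)"
  using g by (simp add: two_riemannian_metric_def)

lemma metric_fun_same_right:
  assumes "X \<in> vector_fields A" "W \<in> vector_fields A"
  shows "metric_fun g X W W = 0"
  using assms
  by (simp add: metric_fun_def fun_eq_iff vf_tangent[OF A]
      two_inner_product_same_right[OF two_inner_product_at subspace_tangent_space[OF A]])

lemma metric_fun_mult_third:
  assumes "X \<in> vector_fields A" "Y \<in> vector_fields A" "W \<in> vector_fields A"
  shows "metric_fun g X Y (vf_mult \<phi> W) = \<phi> * \<phi> * metric_fun g X Y W"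
  using assms
  by (simp add: metric_fun_def vf_mult_def fun_eq_iff vf_tangent[OF A]
      two_inner_product_scale_right[OF two_inner_product_at subspace_tangent_space[OF A]])

section \<open>The Koszul formula at (X,X)(W,W) as the obstruction\<close>

text \<open>With Y = X and Z = W the first two terms and the [X,X] term contain g(X,W/W), g(W,X/W)
  or g([X,X],W/W), all zero. The last two terms coincide by antisymmetry of the bracket, whence the
  factor 2.\<close>

lemma koszul_formula_diagonal:
  assumes X: "X \<in> vector_fields A" and W: "W \<in> vector_fields A"
    and 0: "koszul_formula A g X X W W = 0"
  shows "vf_apply W (metric_fun g X X W) = 2 *\<^sub>R metric_fun g (lie_bracket W X) X W"
proof -
  have br: "lie_bracket W X \<in> vector_fields A"
    using vector_fields_lie_bracket[OF A W X] .
  have [simp]: "metric_fun g X W W = 0" "metric_fun g W X W = 0" "vf_apply X 0 = 0"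
    "metric_fun g (lie_bracket X X) W W = 0"
    "metric_fun g (lie_bracket X W) X W = - metric_fun g (lie_bracket W X) X W"
    using X W br metric_fun_same_right metric_fun_sym[OF A g W X W]
      vector_fields_lie_bracket[OF A X X] metric_fun_uminus[OF A g br X W]
    by (simp_all add: lie_bracket_swap[OF A, of X W] vf_apply_def fun_eq_iff vf_zero[OF A])
  show ?thesis
    using 0 X W by (simp add: koszul_formula_def fun_eq_iff algebra_simps)
qed

lemma koszul_formula_not_alternating:
  assumes dim: "DIM('e) \<ge> 2"
  obtains X W where "X \<in> vector_fields A" "W \<in> vector_fields A" "koszul_formula A g X X W W \<noteq> 0"
proof (rule ccontr)
  assume "\<not> thesis"
  with that have alt: "koszul_formula A g X X W W = 0"
    if "X \<in> vector_fields A" "W \<in> vector_fields A" for X W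
    using that by blast
  obtain X W p where X: "X \<in> vector_fields A" and W: "W \<in> vector_fields A"
    and indep: "\<not> lin_dep_pair (X p) (W p)"
    using ex_independent_vector_fields[OF dim] by metis
  have "W p \<noteq> 0"
  proof
    assume "W p = 0"
    then have "lin_dep_pair (X p) (W p)"
      unfolding lin_dep_pair_def by (intro exI[of _ 0] exI[of _ 1]) simp
    with indep show False ..
  qed
  then obtain \<phi> where \<phi>: "\<phi> \<in> smooth_functions A" "\<phi> p \<noteq> 0" "W p \<phi> \<noteq> 0"
    using ex_smooth_function_nonzero[OF W] by metis
  let ?F = "metric_fun g X X W" and ?G = "metric_fun g (lie_bracket W X) X W"
  have F: "?F \<in> smooth_functions A" using metric_fun_smooth[OF A g] X W by simp
  have br: "lie_bracket W X \<in> vector_fields A" using vector_fields_lie_bracket[OF A W X] .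
  have \<phi>W: "vf_mult \<phi> W \<in> vector_fields A" and \<phi>br: "vf_mult \<phi> (lie_bracket W X) \<in> vector_fields A"
    and X\<phi>W: "vf_mult (vf_apply X \<phi>) W \<in> vector_fields A"
    using vector_fields_mult[OF A] \<phi>(1) W br vf_smooth[OF A X] by simp_all
  \<comment> \<open>Here [\<phi>W,X] = \<phi>[W,X] - X(\<phi>)W, and the second summand contributes
    a multiple of g(W,X/W) = 0.\<close>
  have "metric_fun g (lie_bracket (vf_mult \<phi> W) X) X W = \<phi> * ?G"
    using metric_fun_diff[OF A g \<phi>br X\<phi>W X W] metric_fun_mult[OF A g br X W, of \<phi>]
      metric_fun_mult[OF A g W X W, of "vf_apply X \<phi>"]
      metric_fun_sym[OF A g W X W] metric_fun_same_right[OF X W]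
    by (simp add: lie_bracket_mult_left[OF A \<phi>(1) W X])
  \<comment> \<open>This is the diagonal identity for \<phi>W, with the factor \<phi> squared taken
    out of the third argument on both sides.\<close>
  then have "\<phi> * vf_apply W (\<phi> * \<phi> * ?F) = 2 *\<^sub>R (\<phi> * \<phi> * (\<phi> * ?G))"
    using koszul_formula_diagonal[OF X \<phi>W alt[OF X \<phi>W]]
      metric_fun_mult_third[OF X X W, of \<phi>]
      metric_fun_mult_third[OF vector_fields_lie_bracket[OF A \<phi>W X] X W, of \<phi>]
    by (simp add: vf_apply_mult_field[OF A])
  \<comment> \<open>Leibniz rule, with W(?F) replaced by twice ?G through the diagonal identity for
    W itself.\<close>
  moreover have "vf_apply W (\<phi> * \<phi> * ?F) = \<phi> * \<phi> * (2 *\<^sub>R ?G) + 2 *\<^sub>R (\<phi> * vf_apply W \<phi> * ?F)"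
    using koszul_formula_diagonal[OF X W alt[OF X W]] \<phi>(1) F
    by (simp add: vf_apply_mult[OF A W] smooth_functions_mult[OF A] fun_eq_iff algebra_simps)
  ultimately have "\<phi> * (\<phi> * \<phi> * (2 *\<^sub>R ?G) + 2 *\<^sub>R (\<phi> * vf_apply W \<phi> * ?F)) = 2 *\<^sub>R (\<phi> * \<phi> * (\<phi> * ?G))"
    by simp
  \<comment> \<open>The ?G terms cancel; only the term that differentiates \<phi> survives.\<close>
  from fun_cong[OF this, of p] have "\<phi> p * (\<phi> p * (W p \<phi> * ?F p)) = 0"
    by (simp add: algebra_simps vf_apply_def)
  then have "g p (X p) (X p) (W p) = 0" using \<phi> by (simp add: metric_fun_def)
  \<comment> \<open>The equality case of positivity in the first axiom.\<close>
  then have "lin_dep_pair (X p) (W p)"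
    using two_inner_product_at[of p] vf_tangent[OF A X, of p] vf_tangent[OF A W, of p]
    unfolding two_inner_product_def by blast
  with indep show False ..
qed

end

end

section \<open>Transfer of the obstruction to the pseudoconnection\<close>

theorem theorem4p9:
  fixes A :: "('a::{t2_space, second_countable_topology}, 'e::euclidean_space) chart set"
    and g :: "'a metric2"
    and nabla :: "'a vfield \<Rightarrow> 'a vfield \<Rightarrow> 'a dmap"
  assumes "smooth_manifold A"
    and "DIM('e) \<ge> 2"
    and "two_riemannian_metric A g"
    and "two_riemannian_pseudoconnection A g nabla"
  shows "\<not> (\<exists>D. koszul_derivative A (metric_hom A g) nabla D)"
proof
  assume "\<exists>D. koszul_derivative A (metric_hom A g) nabla D"
  then obtain D where D: "koszul_derivative A (metric_hom A g) nabla D" ..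
  obtain X W where X: "X \<in> vector_fields A" and W: "W \<in> vector_fields A"
    and nz: "koszul_formula A g X X W W \<noteq> 0"
    using koszul_formula_not_alternating[OF assms(1,3,2)] by metis
  \<comment> \<open>By uniqueness \<open>nabla\<close> is the Koszul formula on vector fields, so
    the supposed D would represent that formula.\<close>
  have "koszul_formula A g X X = metric_hom A g (D X X)" and DX: "D X X \<in> vector_fields A"
    using two_riemannian_pseudoconnection_iff[OF assms(1,3)] assms(4) D X
    unfolding koszul_derivative_def by metis+
  then have "koszul_formula A g X X W W = metric_fun g (D X X) W W"
    using W by (simp add: metric_hom_def)
  also have "\<dots> = 0" using metric_fun_same_right[OF assms(1,3) DX W] .
  finally show False using nz by simp
qed

end
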